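(* There exist a Kreĭn space $\mathcal{H}$, a bounded selfadjoint operator $A\in\mathcal{L}(\mathcal{H})$, and a Kreĭn space $(\mathcal{K},\Pi)$ induced by $A$ such that $(\mathcal{K},\Pi)$ does not have the lifting property.
   Context: A Kreĭn space is an indefinite inner product space $(\mathcal{H},[\cdot,\cdot])$ for which there is a positive inner product $\langle\cdot,\cdot\rangle$ turning $\mathcal{H}$ into a Hilbert space, and an operator $J$ on $\mathcal{H}$ with $J=J^*=J^{-1}$ (a fundamental symmetry), such that $[\xi,\eta]=\langle J\xi,\eta\rangle$ for all $\xi,\eta$. The Hilbert space topology (strong topology) does not depend on the choice of $J$. For Kreĭn spaces $\mathcal{H},\mathcal{K}$, $\mathcal{L}(\mathcal{H},\mathcal{K})$ is the set of bounded linear operators from $\mathcal{H}$ to $\mathcal{K}$, $\mathcal{L}(\mathcal{H})=\mathcal{L}(\mathcal{H},\mathcal{H})$, and $T^\sharp$ is the adjoint of $T$ with respect to the indefinite inner products. $A\in\mathcal{L}(\mathcal{H})$ is selfadjoint if $A^\sharp=A$. Kreĭn space induced by $A$: for a selfadjoint $A\in\mathcal{L}(\mathcal{H})$, a pair $(\mathcal{K},\Pi)$ consisting of a Kreĭn space $\mathcal{K}$ and $\Pi\in\mathcal{L}(\mathcal{H},\mathcal{K})$ with dense range such that $[\Pi\xi,\Pi\eta]_{\mathcal{K}}=[A\xi,\eta]_{\mathcal{H}}$ for all $\xi,\eta\in\mathcal{H}$. Lifting property: a Kreĭn space $(\mathcal{K},\Pi)$ induced by $A$ has the lifting property if for any pair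 of operators $T,S\in\mathcal{L}(\mathcal{H})$ with $AT=SA$ there exist unique operators $\tilde T,\tilde S\in\mathcal{L}(\mathcal{K})$ such that $\tilde T\Pi=\Pi T$ and $\tilde S\Pi=\Pi S^\sharp$. *)

theory Defs
  imports "HOL-Analysis.Analysis" "HOL-Library.FuncSet" "HOL-Library.Function_Algebras"
begin

text \<open>
  A complex vector space with a form is given by a carrier inside an ambient type.  Addition and
  zero are those of the ambient type, so the carrier is required to be a linear subspace of it.
\<close>

record 'a form_space =
  carrier :: "'a set"
  scale :: "complex \<Rightarrow> 'a \<Rightarrow> 'a"
  form :: "'a \<Rightarrow> 'a \<Rightarrow> complex"

text \<open>Forms are linear in the first and conjugate linear in the second argument.\<close>

definition inner_product_space :: "'a::ab_group_add form_space \<Rightarrow> bool" where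
  "inner_product_space H \<longleftrightarrow>
     vector_space (scale H) \<and> module.subspace (scale H) (carrier H) \<and>
     (\<forall>x\<in>carrier H. \<forall>y\<in>carrier H. \<forall>z\<in>carrier H. form H (x + y) z = form H x z + form H y z) \<and>
     (\<forall>a. \<forall>x\<in>carrier H. \<forall>y\<in>carrier H. form H (scale H a x) y = a * form H x y) \<and>
     (\<forall>x\<in>carrier H. \<forall>y\<in>carrier H. form H y x = cnj (form H x y))"

definition form_norm :: "'a form_space \<Rightarrow> 'a \<Rightarrow> real" where
  "form_norm H x = sqrt (Re (form H x x))"

text \<open>
  The value outside the carrier is irrelevant; it is fixed because the locale
  \<open>Metric_space\<close> asks for nonnegativity and symmetry on the whole type.
\<close>

definition form_dist :: "'a::ab_group_add form_space \<Rightarrow> 'a \<Rightarrow> 'a \<Rightarrow> real" where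
  "form_dist H x y =
     (if x \<in> carrier H \<and> y \<in> carrier H then form_norm H (x - y) else 0)"

text \<open>By the Hermitian law \<open>form H x x\<close> is real.\<close>

definition hilbert_space :: "'a::ab_group_add form_space \<Rightarrow> bool" where
  "hilbert_space H \<longleftrightarrow>
     inner_product_space H \<and>
     (\<forall>x\<in>carrier H. x \<noteq> 0 \<longrightarrow> 0 < Re (form H x x)) \<and>
     Metric_space.mcomplete (carrier H) (form_dist H)"

definition linear_between ::
  "'a::ab_group_add form_space \<Rightarrow> 'b::ab_group_add form_space \<Rightarrow> ('a \<Rightarrow> 'b) \<Rightarrow> bool" where
  "linear_between H K T \<longleftrightarrow>
     T \<in> carrier H \<rightarrow> carrier K \<and>
     (\<forall>x\<in>carrier H. \<forall>y\<in>carrier H. T (x + y) = T x + T y) \<and>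
     (\<forall>a. \<forall>x\<in>carrier H. T (scale H a x) = scale K a (T x))"

text \<open>
  \<open>ip\<close> is a Hilbert space inner product on the carrier of \<open>H\<close>, and \<open>J\<close> is a fundamental symmetry
  for it.  For the everywhere defined \<open>J\<close>, the last three clauses say \<open>J = J*\<close>, \<open>J = J\<inverse>\<close> and
  \<open>[x, y] = \<langle>J x, y\<rangle>\<close>.
\<close>

definition fundamental_symmetry ::
  "'a::ab_group_add form_space \<Rightarrow> ('a \<Rightarrow> 'a \<Rightarrow> complex) \<Rightarrow> ('a \<Rightarrow> 'a) \<Rightarrow> bool" where
  "fundamental_symmetry H ip J \<longleftrightarrow>
     hilbert_space (H\<lparr>form := ip\<rparr>) \<and>
     linear_between H H J \<and>
     (\<forall>x\<in>carrier H. \<forall>y\<in>carrier H. ip (J x) y = ip x (J y)) \<and>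
     (\<forall>x\<in>carrier H. J (J x) = x) \<and>
     (\<forall>x\<in>carrier H. \<forall>y\<in>carrier H. form H x y = ip (J x) y)"

definition krein_space :: "'a::ab_group_add form_space \<Rightarrow> bool" where
  "krein_space H \<longleftrightarrow> inner_product_space H \<and> (\<exists>ip J. fundamental_symmetry H ip J)"

text \<open>
  The Hilbert space attached to a Krein space by some choice of fundamental symmetry.  Different
  choices give equivalent norms, so the strong topology, boundedness of operators and density
  do not depend on the choice.
\<close>

definition assoc_hilbert :: "'a::ab_group_add form_space \<Rightarrow> 'a form_space" where
  "assoc_hilbert H = H\<lparr>form := (SOME ip. \<exists>J. fundamental_symmetry H ip J)\<rparr>"

definition strong_norm :: "'a::ab_group_add form_space \<Rightarrow> 'a \<Rightarrow> real" where
  "strong_norm H = form_norm (assoc_hilbert H)"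

definition strong_topology :: "'a::ab_group_add form_space \<Rightarrow> 'a topology" where
  "strong_topology H = Metric_space.mtopology (carrier H) (form_dist (assoc_hilbert H))"

text \<open>
  Operators are extensional (\<open>undefined\<close> outside the carrier), so that equality of operators
  is equality of HOL functions; products of operators are formed with \<open>compose\<close>.
\<close>

definition bounded_ops ::
  "'a::ab_group_add form_space \<Rightarrow> 'b::ab_group_add form_space \<Rightarrow> ('a \<Rightarrow> 'b) set" where
  "bounded_ops H K =
     {T \<in> carrier H \<rightarrow>\<^sub>E carrier K. linear_between H K T \<and>
        (\<exists>c. \<forall>x\<in>carrier H. strong_norm K (T x) \<le> c * strong_norm H x)}"

definition form_adjoint ::
  "'a::ab_group_add form_space \<Rightarrow> 'b::ab_group_add form_space \<Rightarrow> ('a \<Rightarrow> 'b) \<Rightarrow> ('b \<Rightarrow> 'a)" where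
  "form_adjoint H K T =
     (THE S. S \<in> bounded_ops K H \<and>
        (\<forall>x\<in>carrier H. \<forall>y\<in>carrier K. form K (T x) y = form H x (S y)))"

definition selfadjoint_op :: "'a::ab_group_add form_space \<Rightarrow> ('a \<Rightarrow> 'a) \<Rightarrow> bool" where
  "selfadjoint_op H A \<longleftrightarrow> A \<in> bounded_ops H H \<and> form_adjoint H H A = A"

definition induced_krein_space ::
  "'a::ab_group_add form_space \<Rightarrow> ('a \<Rightarrow> 'a) \<Rightarrow> 'b::ab_group_add form_space \<Rightarrow> ('a \<Rightarrow> 'b) \<Rightarrow> bool"
  where
  "induced_krein_space H A K P \<longleftrightarrow>
     krein_space K \<and> P \<in> bounded_ops H K \<and>
     strong_topology K closure_of (P ` carrier H) = carrier K \<and>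
     (\<forall>x\<in>carrier H. \<forall>y\<in>carrier H. form K (P x) (P y) = form H (A x) y)"

definition lifting_property ::
  "'a::ab_group_add form_space \<Rightarrow> ('a \<Rightarrow> 'a) \<Rightarrow> 'b::ab_group_add form_space \<Rightarrow> ('a \<Rightarrow> 'b) \<Rightarrow> bool"
  where
  "lifting_property H A K P \<longleftrightarrow>
     (\<forall>T\<in>bounded_ops H H. \<forall>S\<in>bounded_ops H H.
        compose (carrier H) A T = compose (carrier H) S A \<longrightarrow>
        (\<exists>!T'. T' \<in> bounded_ops K K \<and>
           compose (carrier H) T' P = compose (carrier H) P T) \<and>
        (\<exists>!S'. S' \<in> bounded_ops K K \<and>
           compose (carrier H) S' P = compose (carrier H) P (form_adjoint H H S)))"

end

theory Submission
  imports Defs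
begin

text \<open>
  On a direct sum of hyperbolic planes with the form \<open>[(x, y), (u, v)] = \<langle>x, v\<rangle> + \<langle>y, u\<rangle>\<close>, the
  operator \<open>\<Pi> (x, y) = (x, D y)\<close> with \<open>D\<close> diagonal, injective and compact induces the operator
  \<open>A (x, y) = (D y, D x)\<close> on the Hilbert space \<open>\<ell>\<^sup>2 \<oplus> \<ell>\<^sup>2\<close>.  Then \<open>T (x, y) = (y, 0)\<close> and
  \<open>S (x, y) = (0, x)\<close> satisfy \<open>A T = S A\<close>, but a lift of \<open>T\<close> would map \<open>(0, D y)\<close> to \<open>(y, 0)\<close>,
  which is unbounded.  The two summands are interleaved as the even and the odd indices of one
  sequence.  The strong norm comes from an arbitrary fundamental symmetry, so one also needs that
  all fundamental symmetries give equivalent norms; this follows from Baire's theorem.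
\<close>

section \<open>Positive definite forms\<close>

text \<open>Completeness is left out, so that Cauchy-Schwarz and the metric are already available
  while \<open>ell2\<close> is being shown to be complete.\<close>

locale pre_hilbert =
  fixes H :: "'a::ab_group_add form_space"
  assumes inner_product_space: "inner_product_space H"
    and pos: "x \<in> carrier H \<Longrightarrow> x \<noteq> 0 \<Longrightarrow> 0 < Re (form H x x)"
begin

sublocale vector_space "scale H"
  using inner_product_space by (simp add: inner_product_space_def)

lemma subspace_carrier: "subspace (carrier H)"
  using inner_product_space by (simp add: inner_product_space_def)

lemmas carrier_zero [simp] = subspace_0[OF subspace_carrier]
lemmas carrier_add [simp] = subspace_add[OF subspace_carrier]
lemmas carrier_diff [simp] = subspace_diff[OF subspace_carrier]
lemmas carrier_scale [simp] = subspace_scale[OF subspace_carrier]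

lemma form_add_left:
  "x \<in> carrier H \<Longrightarrow> y \<in> carrier H \<Longrightarrow> z \<in> carrier H \<Longrightarrow>
     form H (x + y) z = form H x z + form H y z"
  using inner_product_space unfolding inner_product_space_def by blast

lemma form_scale_left:
  "x \<in> carrier H \<Longrightarrow> y \<in> carrier H \<Longrightarrow> form H (scale H a x) y = a * form H x y"
  using inner_product_space unfolding inner_product_space_def by blast

lemma form_commute:
  "x \<in> carrier H \<Longrightarrow> y \<in> carrier H \<Longrightarrow> form H y x = cnj (form H x y)"
  using inner_product_space unfolding inner_product_space_def by blast

lemma form_diff_left:
  assumes "x \<in> carrier H" "y \<in> carrier H" "z \<in> carrier H"
  shows "form H (x - y) z = form H x z - form H y z"
  using form_add_left[of "x - y" y z] assms by (simp add: algebra_simps)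

lemma form_add_right:
  "x \<in> carrier H \<Longrightarrow> y \<in> carrier H \<Longrightarrow> z \<in> carrier H \<Longrightarrow>
     form H z (x + y) = form H z x + form H z y"
  by (metis carrier_add complex_cnj_add form_add_left form_commute)

lemma form_diff_right:
  "x \<in> carrier H \<Longrightarrow> y \<in> carrier H \<Longrightarrow> z \<in> carrier H \<Longrightarrow>
     form H z (x - y) = form H z x - form H z y"
  by (metis carrier_diff complex_cnj_diff form_diff_left form_commute)

lemma form_scale_right:
  "x \<in> carrier H \<Longrightarrow> y \<in> carrier H \<Longrightarrow> form H x (scale H a y) = cnj a * form H x y"
  by (metis carrier_scale complex_cnj_mult form_scale_left form_commute)

lemma form_zero_left: "x \<in> carrier H \<Longrightarrow> form H 0 x = 0"
  using form_diff_left[of 0 0 x] by simp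

lemma form_zero_right: "x \<in> carrier H \<Longrightarrow> form H x 0 = 0"
  using form_diff_right[of 0 0 x] by simp

lemma form_self_nonneg: "x \<in> carrier H \<Longrightarrow> 0 \<le> Re (form H x x)"
  using pos[of x] form_zero_left[of 0] by (cases "x = 0") auto

lemma form_norm_nonneg [simp]: "x \<in> carrier H \<Longrightarrow> 0 \<le> form_norm H x"
  by (simp add: form_norm_def form_self_nonneg)

lemma form_self:
  assumes "x \<in> carrier H"
  shows "form H x x = of_real ((form_norm H x)\<^sup>2)"
proof -
  have "Im (form H x x) = 0"
    using arg_cong[OF form_commute[OF assms assms], of Im] by simp
  then show ?thesis
    using form_self_nonneg[OF assms] by (simp add: form_norm_def complex_eq_iff)
qed

lemma form_norm_eq_0_iff [simp]: "x \<in> carrier H \<Longrightarrow> form_norm H x = 0 \<longleftrightarrow> x = 0"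
  using pos[of x] form_zero_left[of 0] by (cases "x = 0") (auto simp: form_norm_def)

lemma form_norm_pos: "x \<in> carrier H \<Longrightarrow> x \<noteq> 0 \<Longrightarrow> 0 < form_norm H x"
  by (simp add: less_le)

lemma form_norm_zero [simp]: "form_norm H 0 = 0"
  using form_norm_eq_0_iff[of 0] carrier_zero by blast

lemma form_norm_scale:
  assumes "x \<in> carrier H"
  shows "form_norm H (scale H a x) = cmod a * form_norm H x"
proof -
  have "form H (scale H a x) (scale H a x) = (a * cnj a) * form H x x"
    using assms by (simp add: form_scale_left form_scale_right)
  also have "\<dots> = of_real ((cmod a * form_norm H x)\<^sup>2)"
    using assms by (simp only: form_self complex_norm_square[symmetric]) (simp add: power_mult_distrib)
  finally have "Re (form H (scale H a x) (scale H a x)) = (cmod a * form_norm H x)\<^sup>2"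
    by simp
  then show ?thesis
    using assms by (simp add: form_norm_def form_self_nonneg)
qed

section \<open>Cauchy-Schwarz, the triangle inequality and the metric\<close>

lemma cauchy_schwarz:
  assumes x: "x \<in> carrier H" and y: "y \<in> carrier H"
  shows "cmod (form H x y) \<le> form_norm H x * form_norm H y"
proof (cases "y = 0")
  case True
  then show ?thesis using x by (simp add: form_zero_right)
next
  case False
  define a where "a = (form_norm H y)\<^sup>2"
  define b where "b = form H x y"
  have a: "a > 0" using False y by (simp add: a_def)
  \<comment> \<open>This is \<open>a\<close> times the component of \<open>x\<close> orthogonal to
    \<open>y\<close>; the factor \<open>a\<close> avoids a division.\<close>
  let ?z = "scale H (of_real a) x - scale H b y"
  have "form H ?z ?z = of_real a * (of_real a * form H x x - b * cnj b)"
    using x y form_commute[OF x y] form_self[OF y]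
    by (simp add: form_diff_left form_diff_right form_scale_left form_scale_right algebra_simps
        flip: a_def b_def)
  also have "\<dots> = of_real (a * (a * (form_norm H x)\<^sup>2 - (cmod b)\<^sup>2))"
    using form_self[OF x] by (simp only: complex_norm_square[symmetric]) simp
  finally have "0 \<le> a * (a * (form_norm H x)\<^sup>2 - (cmod b)\<^sup>2)"
    using form_self_nonneg[of ?z] x y by simp
  then have "(cmod b)\<^sup>2 \<le> (form_norm H x * form_norm H y)\<^sup>2"
    using a by (simp add: zero_le_mult_iff a_def power_mult_distrib mult.commute)
  then show ?thesis
    unfolding b_def by (rule power2_le_imp_le) (simp add: x y)
qed

lemma form_norm_triangle:
  assumes x: "x \<in> carrier H" and y: "y \<in> carrier H"
  shows "form_norm H (x + y) \<le> form_norm H x + form_norm H y"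
proof -
  have "form H (x + y) (x + y) = form H x x + form H y y + (form H x y + cnj (form H x y))"
    using x y form_commute[OF x y] by (simp add: form_add_left form_add_right)
  then have "(form_norm H (x + y))\<^sup>2 = (form_norm H x)\<^sup>2 + (form_norm H y)\<^sup>2 + 2 * Re (form H x y)"
    using form_self[of x] form_self[of y] form_self[of "x + y"] x y
    by (simp add: complex_eq_iff)
  also have "\<dots> \<le> (form_norm H x + form_norm H y)\<^sup>2"
    using cauchy_schwarz[OF x y] complex_Re_le_cmod[of "form H x y"] by (simp add: power2_sum)
  finally show ?thesis
    by (rule power2_le_imp_le) (simp add: x y)
qed

lemma form_norm_uminus: "x \<in> carrier H \<Longrightarrow> form_norm H (- x) = form_norm H x"
  using form_norm_scale[of x "-1"] by simp

lemma form_norm_minus_commute: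
  "x \<in> carrier H \<Longrightarrow> y \<in> carrier H \<Longrightarrow> form_norm H (x - y) = form_norm H (y - x)"
  using form_norm_uminus[of "x - y"] by simp

sublocale Metric_space "carrier H" "form_dist H"
proof
  show "form_dist H x z \<le> form_dist H x y + form_dist H y z"
    if "x \<in> carrier H" "y \<in> carrier H" "z \<in> carrier H" for x y z
    using form_norm_triangle[of "x - y" "y - z"] that by (simp add: form_dist_def)
qed (auto simp: form_dist_def form_norm_minus_commute)

end

section \<open>Fundamental symmetries\<close>

lemma pre_hilbert_fundamental_symmetry:
  "fundamental_symmetry H p J \<Longrightarrow> pre_hilbert (H\<lparr>form := p\<rparr>)"
  by (simp add: fundamental_symmetry_def hilbert_space_def pre_hilbert_def)

lemma fundamental_symmetry_closed:
  "fundamental_symmetry H p J \<Longrightarrow> x \<in> carrier H \<Longrightarrow> J x \<in> carrier H"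
  by (auto simp: fundamental_symmetry_def linear_between_def)

text \<open>Since \<open>J\<close> is symmetric and an involution,
  \<open>[x, J x] = p (J x) (J x) = p x x\<close>. So the indefinite form determines the Hilbert
  norm once \<open>J\<close> is known.\<close>

lemma form_fundamental_symmetry_right:
  assumes "fundamental_symmetry H p J" "x \<in> carrier H"
  shows "form H x (J x) = of_real ((form_norm (H\<lparr>form := p\<rparr>) x)\<^sup>2)"
  using assms fundamental_symmetry_closed[OF assms]
    pre_hilbert.form_self[OF pre_hilbert_fundamental_symmetry[OF assms(1)], of x]
  by (simp add: fundamental_symmetry_def)

lemma form_norm_fundamental_symmetry:
  assumes "fundamental_symmetry H p J" "x \<in> carrier H"
  shows "form_norm (H\<lparr>form := p\<rparr>) (J x) = form_norm (H\<lparr>form := p\<rparr>) x"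
  using assms fundamental_symmetry_closed[OF assms]
  by (simp add: fundamental_symmetry_def form_norm_def)

text \<open>Cauchy-Schwarz for \<open>J x\<close> and \<open>y\<close>, where \<open>J\<close> is
  isometric.\<close>

lemma form_le_norms:
  assumes "fundamental_symmetry H p J" "x \<in> carrier H" "y \<in> carrier H"
  shows "cmod (form H x y) \<le> form_norm (H\<lparr>form := p\<rparr>) x * form_norm (H\<lparr>form := p\<rparr>) y"
  using pre_hilbert.cauchy_schwarz[OF pre_hilbert_fundamental_symmetry[OF assms(1)], of "J x" y]
    fundamental_symmetry_closed[OF assms(1,2)] assms form_norm_fundamental_symmetry[OF assms(1,2)]
  by (simp add: fundamental_symmetry_def)

text \<open>Additivity passes from \<open>p\<close> to \<open>form H\<close> through
  \<open>form H x y = p (J x) y\<close> and the linearity of \<open>J\<close>.\<close>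

lemma form_add_fundamental_symmetry:
  assumes f: "fundamental_symmetry H p J"
    and x: "x \<in> carrier H" and y: "y \<in> carrier H" and z: "z \<in> carrier H"
  shows "form H (x + y) z = form H x z + form H y z"
proof -
  interpret pre_hilbert "H\<lparr>form := p\<rparr>"
    using f by (rule pre_hilbert_fundamental_symmetry)
  have "J (x + y) = J x + J y"
    using f x y by (simp add: fundamental_symmetry_def linear_between_def)
  then show ?thesis
    using f x y z carrier_add[of x y] form_add_left[of "J x" "J y" z]
      fundamental_symmetry_closed[OF f x] fundamental_symmetry_closed[OF f y]
    by (simp add: fundamental_symmetry_def)
qed

text \<open>Each inequality on the right is a closed condition for the norm of any other fundamental
  symmetry; hence the balls of one norm are closed for the other, as Baire's theorem requires.\<close>

lemma form_norm_le_iff: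
  assumes f: "fundamental_symmetry H p J" and x: "x \<in> carrier H" and k: "0 \<le> k"
  shows "form_norm (H\<lparr>form := p\<rparr>) x \<le> k \<longleftrightarrow>
    (\<forall>y\<in>carrier H. cmod (form H x y) \<le> k * form_norm (H\<lparr>form := p\<rparr>) y)" (is "?n x \<le> k \<longleftrightarrow> ?R")
proof -
  interpret pre_hilbert "H\<lparr>form := p\<rparr>"
    using f by (rule pre_hilbert_fundamental_symmetry)
  show ?thesis
  proof
    assume "?n x \<le> k"
    then show ?R
      using form_le_norms[OF f x] form_norm_nonneg
      by (force intro: order_trans mult_right_mono)
  next
    assume ?R
    \<comment> \<open>The extremal test vector is \<open>y = J x\<close>: the left side becomes the
      squared norm of \<open>x\<close>, and \<open>J x\<close> has the same norm as
      \<open>x\<close>.\<close>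
    then have "cmod (form H x (J x)) \<le> k * ?n (J x)"
      using fundamental_symmetry_closed[OF f x] by blast
    then have "(?n x)\<^sup>2 \<le> k * ?n x"
      by (simp only: form_fundamental_symmetry_right[OF f x] form_norm_fundamental_symmetry[OF f x]
          norm_of_real abs_power2)
    then show "?n x \<le> k"
      using x k form_norm_nonneg[of x] by (auto simp: power2_eq_square mult_le_cancel_right)
  qed
qed

text \<open>The \<open>q\<close>-balls \<open>B k\<close> cover the space and are closed for the
  complete \<open>p\<close>-metric, so by Baire one of them contains a \<open>p\<close>-ball. Moving
  that ball to the origin and rescaling bounds \<open>q\<close> by a multiple of \<open>p\<close>;
  exchanging the roles of \<open>p\<close> and \<open>q\<close> then gives equivalence.\<close>

lemma fundamental_symmetry_norm_le:
  assumes p: "fundamental_symmetry H p J" and q: "fundamental_symmetry H q L"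
  obtains C where "C > 0"
    "\<And>x. x \<in> carrier H \<Longrightarrow> form_norm (H\<lparr>form := q\<rparr>) x \<le> C * form_norm (H\<lparr>form := p\<rparr>) x"
proof -
  let ?p = "form_norm (H\<lparr>form := p\<rparr>)" and ?q = "form_norm (H\<lparr>form := q\<rparr>)"
  interpret P: pre_hilbert "H\<lparr>form := p\<rparr>"
    rewrites "carrier (H\<lparr>form := p\<rparr>) = carrier H"
    using p by (simp_all add: pre_hilbert_fundamental_symmetry)
  interpret Q: pre_hilbert "H\<lparr>form := q\<rparr>"
    rewrites "carrier (H\<lparr>form := q\<rparr>) = carrier H"
    using q by (simp_all add: pre_hilbert_fundamental_symmetry)
  note closed = P.carrier_add P.carrier_diff P.carrier_scale P.carrier_zero
  have complete: "P.mcomplete"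
    using p by (simp add: fundamental_symmetry_def hilbert_space_def)
  define B where "B k = {x \<in> carrier H. ?q x \<le> real k}" for k
  have closed_B: "closedin P.mtopology (B k)" for k
  proof -
    have "\<exists>r>0. P.mball x r \<subseteq> carrier H - B k" if x: "x \<in> carrier H - B k" for x
    proof -
      have "\<not> (\<forall>y\<in>carrier H. cmod (form H x y) \<le> k * ?q y)"
        using x form_norm_le_iff[OF q, of x "real k"] by (simp add: B_def)
      then obtain y where y: "y \<in> carrier H" "k * ?q y < cmod (form H x y)"
        by (meson not_le)
      \<comment> \<open>The radius is small enough that moving \<open>x\<close> by less than
        \<open>r\<close> changes the pairing with \<open>y\<close> by less than the gap in the
        numerator. The added 1 keeps the denominator positive.\<close>
      define r where "r = (cmod (form H x y) - k * ?q y) / (1 + ?p y)"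
      have py: "0 \<le> ?p y" using P.form_norm_nonneg y by simp
      have r: "r > 0" unfolding r_def using y(2) py by (intro divide_pos_pos) linarith+
      have "z \<notin> B k" if z: "z \<in> carrier H" "?p (x - z) < r" for z
      proof
        assume "z \<in> B k"
        then have "cmod (form H z y) \<le> k * ?q y"
          using form_norm_le_iff[OF q, of z "real k"] z y by (auto simp: B_def)
        moreover have "form H x y = form H z y + form H (x - z) y"
          using form_add_fundamental_symmetry[OF q, of z "x - z" y] closed(2)[of x z] x y z by simp
        moreover have "cmod (form H (x - z) y) \<le> ?p (x - z) * ?p y"
          using form_le_norms[OF p, of "x - z" y] closed(2)[of x z] x y z by simp
        moreover have "?p (x - z) * ?p y \<le> r * ?p y"
          using z py by (intro mult_right_mono) auto
        moreover have "r * ?p y < cmod (form H x y) - k * ?q y"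
        proof -
          have "r * (1 + ?p y) = cmod (form H x y) - k * ?q y"
            using py by (simp add: r_def)
          then show ?thesis using r by (simp add: algebra_simps)
        qed
        ultimately show False
          using norm_triangle_ineq[of "form H z y" "form H (x - z) y"] by simp
      qed
      then have "P.mball x r \<subseteq> carrier H - B k"
        using x by (auto simp: P.in_mball form_dist_def)
      with r show ?thesis by blast
    qed
    then have "openin P.mtopology (carrier H - B k)"
      by (simp add: P.openin_mtopology)
    moreover have "B k \<subseteq> carrier H" by (auto simp: B_def)
    ultimately show ?thesis by (simp add: closedin_def)
  qed
  have cover: "\<Union>(range B) = carrier H"
    using real_arch_simple by (auto simp: B_def)
  have "\<exists>k. P.mtopology interior_of (B k) \<noteq> {}"
  proof (rule ccontr)
    assume "\<nexists>k. P.mtopology interior_of (B k) \<noteq> {}"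
    then have "P.mtopology interior_of \<Union>(range B) = {}"
      using closed_B by (intro P.metric_Baire_category_alt[OF complete]) auto
    \<comment> \<open>The whole space is its own interior and contains 0, so the union of the
      \<open>B k\<close> cannot have empty interior.\<close>
    moreover have "P.mtopology interior_of (carrier H) = carrier H"
      using interior_of_topspace[of P.mtopology] by simp
    ultimately show False using cover closed(4) by auto
  qed
  then obtain k x r where x: "x \<in> carrier H" and r: "r > 0" and sub: "P.mball x r \<subseteq> B k"
    by (auto simp: P.metric_interior_of)
  have xk: "?q x \<le> k" using sub x r by (auto simp: B_def)
  \<comment> \<open>Here \<open>z\<close> is the difference of \<open>x + z\<close> and
    \<open>x\<close>, both of which lie in \<open>B k\<close>.\<close>
  have small: "?q z \<le> 2 * k" if z: "z \<in> carrier H" "?p z < r" for z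
  proof -
    have "x + z \<in> P.mball x r"
      using x z P.form_norm_uminus[of z] closed(1)[of x z] by (simp add: P.in_mball form_dist_def)
    then have "?q (x + z) \<le> k" using sub by (auto simp: B_def)
    then show ?thesis
      using Q.form_norm_triangle[of "x + z" "- x"] Q.form_norm_uminus[of x] xk x z
        closed(1)[of x z] closed(2)[of 0 x] closed(4) by simp
  qed
  show thesis
  proof (rule that)
    \<comment> \<open>Rescaling to \<open>p\<close>-norm \<open>r / 2\<close> gives the factor
      \<open>4 * k / r\<close>; \<open>k + 1\<close> in place of \<open>k\<close> keeps the constant
      positive when \<open>k = 0\<close>.\<close>
    show "4 * (k + 1) / r > 0" using r by simp
    fix x assume x: "x \<in> carrier H"
    show "?q x \<le> 4 * (k + 1) / r * ?p x"
    proof (cases "x = 0")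
      case True
      then show ?thesis by simp
    next
      case False
      then have px: "?p x > 0"
        using x by (simp add: P.form_norm_pos)
      define t where "t = r / (2 * ?p x)"
      have t: "t > 0" using r px by (simp add: t_def)
      have "?p (scale H (of_real t) x) = r / 2"
      proof -
        have "?p (scale H (of_real t) x) = t * ?p x"
          using P.form_norm_scale[of x "of_real t"] x t by simp
        then show ?thesis using px by (simp add: t_def)
      qed
      then have "?q (scale H (of_real t) x) \<le> 2 * k"
        using small closed(3)[of x "of_real t"] x r by simp
      then have "t * ?q x \<le> 2 * k"
        using Q.form_norm_scale[of x "of_real t"] x t by simp
      then have "?q x \<le> 2 * k / t" using t by (simp add: field_simps)
      also have "\<dots> \<le> 4 * (k + 1) / r * ?p x"
        using r px by (simp add: t_def field_simps)
      finally show ?thesis .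
    qed
  qed
qed

section \<open>Strong norm and strong topology in terms of an explicit fundamental symmetry\<close>

lemma fundamental_symmetry_assoc_hilbert:
  assumes "fundamental_symmetry H p J"
  obtains q L where "fundamental_symmetry H q L" "assoc_hilbert H = H\<lparr>form := q\<rparr>"
  using someI_ex[of "\<lambda>ip. \<exists>J. fundamental_symmetry H ip J"] assms
  unfolding assoc_hilbert_def by blast

text \<open>Estimates for the norm picked by \<open>SOME\<close> can thus be carried out in an
  explicit Hilbert norm, at the price of constants.\<close>

lemma strong_norm_equivalent:
  assumes "fundamental_symmetry H p J"
  obtains C D where "C > 0" "D > 0"
    "\<And>x. x \<in> carrier H \<Longrightarrow> strong_norm H x \<le> C * form_norm (H\<lparr>form := p\<rparr>) x"
    "\<And>x. x \<in> carrier H \<Longrightarrow> form_norm (H\<lparr>form := p\<rparr>) x \<le> D * strong_norm H x"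
  using fundamental_symmetry_assoc_hilbert[OF assms] fundamental_symmetry_norm_le assms
  unfolding strong_norm_def by metis

text \<open>Approximation in one explicit norm is enough, because the chosen norm is at most a
  multiple of it.\<close>

lemma strong_closure_of:
  assumes p: "fundamental_symmetry H p J" and X: "X \<subseteq> carrier H"
    and approx: "\<And>z e. z \<in> carrier H \<Longrightarrow> e > 0 \<Longrightarrow>
      \<exists>x\<in>X. form_norm (H\<lparr>form := p\<rparr>) (z - x) < e"
  shows "strong_topology H closure_of X = carrier H"
proof -
  obtain q L where q: "fundamental_symmetry H q L" "assoc_hilbert H = H\<lparr>form := q\<rparr>"
    using fundamental_symmetry_assoc_hilbert[OF p] .
  interpret Q: pre_hilbert "H\<lparr>form := q\<rparr>"
    rewrites "carrier (H\<lparr>form := q\<rparr>) = carrier H"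
    using q(1) by (simp_all add: pre_hilbert_fundamental_symmetry)
  obtain C where C: "C > 0"
    "\<And>x. x \<in> carrier H \<Longrightarrow> form_norm (H\<lparr>form := q\<rparr>) x \<le> C * form_norm (H\<lparr>form := p\<rparr>) x"
    using fundamental_symmetry_norm_le[OF p q(1)] by blast
  have "\<exists>x\<in>X. x \<in> Q.mball z e" if z: "z \<in> carrier H" and e: "e > 0" for z e
  proof -
    obtain x where x: "x \<in> X" "form_norm (H\<lparr>form := p\<rparr>) (z - x) < e / C"
      using approx[OF z, of "e / C"] e C(1) by auto
    have "form_norm (H\<lparr>form := q\<rparr>) (z - x) \<le> C * form_norm (H\<lparr>form := p\<rparr>) (z - x)"
      using C(2) Q.carrier_diff[of z x] x X z by auto
    also have "\<dots> < e" using x C(1) by (simp add: field_simps)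
    finally have "x \<in> Q.mball z e"
      unfolding Q.in_mball using x X z by (auto simp: form_dist_def)
    then show ?thesis using x by blast
  qed
  then have "Q.mtopology closure_of X = carrier H"
    unfolding Q.metric_closure_of by auto
  then show ?thesis
    by (simp add: strong_topology_def q(2))
qed

section \<open>Square summable sequences\<close>

definition ell2 :: "(nat \<Rightarrow> complex) set" where
  "ell2 = {x. (\<lambda>n. (cmod (x n))\<^sup>2) summable_on UNIV}"

definition ell2_inner :: "(nat \<Rightarrow> complex) \<Rightarrow> (nat \<Rightarrow> complex) \<Rightarrow> complex" where
  "ell2_inner x y = (\<Sum>\<^sub>\<infinity>n. x n * cnj (y n))"

text \<open>For an involution \<tau> of the indices, composition with \<tau> is a fundamental
  symmetry of this form. The case \<open>id\<close> is the Hilbert space itself; a \<tau> that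
  exchanges indices in pairs gives a sum of hyperbolic planes.\<close>

definition ell2_space :: "(nat \<Rightarrow> nat) \<Rightarrow> (nat \<Rightarrow> complex) form_space" where
  "ell2_space \<tau> = \<lparr>carrier = ell2, scale = (\<lambda>a x n. a * x n), form = (\<lambda>x. ell2_inner (x \<circ> \<tau>))\<rparr>"

lemma ell2_space_simps [simp]:
  "carrier (ell2_space \<tau>) = ell2"
  "scale (ell2_space \<tau>) = (\<lambda>a x n. a * x n)"
  "form (ell2_space \<tau>) = (\<lambda>x. ell2_inner (x \<circ> \<tau>))"
  "ell2_space \<tau>\<lparr>form := ell2_inner\<rparr> = ell2_space id"
  by (simp_all add: ell2_space_def)

lemma ell2_product_summable:
  assumes "x \<in> ell2" "y \<in> ell2"
  shows "(\<lambda>n. x n * cnj (y n)) summable_on UNIV"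
  by (rule abs_summable_summable, rule abs_summable_product)
    (use assms in \<open>simp_all add: ell2_def norm_mult power2_eq_square\<close>)

lemma ell2I:
  assumes "\<And>F. finite F \<Longrightarrow> (\<Sum>n\<in>F. (cmod (x n))\<^sup>2) \<le> b"
  shows "x \<in> ell2"
  unfolding ell2_def mem_Collect_eq
  by (rule nonneg_bdd_above_summable_on) (use assms in \<open>auto intro!: bdd_aboveI2\<close>)

lemma ell2_add:
  assumes "x \<in> ell2" "y \<in> ell2"
  shows "x + y \<in> ell2"
proof -
  have "(\<lambda>n. 2 * (cmod (x n))\<^sup>2 + 2 * (cmod (y n))\<^sup>2) summable_on UNIV"
    using assms by (auto simp: ell2_def intro!: summable_on_add summable_on_cmult_right)
  moreover have "(cmod ((x + y) n))\<^sup>2 \<le> 2 * (cmod (x n))\<^sup>2 + 2 * (cmod (y n))\<^sup>2" for n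
  proof -
    have "(cmod ((x + y) n))\<^sup>2 \<le> (cmod (x n) + cmod (y n))\<^sup>2"
      by (intro power_mono) (auto intro: norm_triangle_ineq)
    also have "\<dots> \<le> 2 * (cmod (x n))\<^sup>2 + 2 * (cmod (y n))\<^sup>2"
      using sum_squares_bound[of "cmod (x n)" "cmod (y n)"] by (simp add: power2_sum)
    finally show ?thesis .
  qed
  ultimately show ?thesis
    unfolding ell2_def mem_Collect_eq by (rule summable_on_comparison_test) auto
qed

lemma ell2_scale: "x \<in> ell2 \<Longrightarrow> (\<lambda>n. a * x n) \<in> ell2"
  by (auto simp: ell2_def norm_mult power_mult_distrib intro!: summable_on_cmult_right)

lemma ell2_permute:
  assumes "x \<in> ell2" "bij \<tau>"
  shows "x \<circ> \<tau> \<in> ell2"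
  using assms summable_on_reindex_bij_betw[of \<tau> UNIV UNIV "\<lambda>n. (cmod (x n))\<^sup>2"]
  by (simp add: ell2_def)

lemma ell2_inner_self:
  assumes "x \<in> ell2"
  shows "ell2_inner x x = of_real (\<Sum>\<^sub>\<infinity>n. (cmod (x n))\<^sup>2)"
proof -
  have "ell2_inner x x = (\<Sum>\<^sub>\<infinity>n. of_real ((cmod (x n))\<^sup>2))"
    by (simp only: ell2_inner_def complex_norm_square)
  also have "\<dots> = of_real (\<Sum>\<^sub>\<infinity>n. (cmod (x n))\<^sup>2)"
    using assms by (intro infsumI has_sum_of_real has_sum_infsum) (simp add: ell2_def)
  finally show ?thesis .
qed

lemma ell2_inner_add: 
  assumes "x \<in> ell2" "y \<in> ell2" "z \<in> ell2"
  shows "ell2_inner (x + y) z = ell2_inner x z + ell2_inner y z"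
  using assms by (simp add: ell2_inner_def ring_distribs infsum_add ell2_product_summable)

lemma ell2_inner_scale: "ell2_inner (\<lambda>n. a * x n) y = a * ell2_inner x y"
  by (simp add: ell2_inner_def mult.assoc infsum_cmult_right')

lemma ell2_inner_commute: "ell2_inner y x = cnj (ell2_inner x y)"
  by (simp add: ell2_inner_def mult.commute flip: infsum_cnj)

lemma involution_bij: "(\<And>n. \<tau> (\<tau> n) = n) \<Longrightarrow> bij \<tau>"
  by (metis bij_betw_def inj_on_def surj_def)

text \<open>Reindexing the sum by \<tau>, its own inverse, moves \<tau> to the other factor. This
  yields both the Hermitian law for \<open>ell2_space\<close> and the symmetry of its
  \<open>J\<close>.\<close>

lemma ell2_inner_permute:
  assumes \<tau>: "\<And>n. \<tau> (\<tau> n) = n"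
  shows "ell2_inner (x \<circ> \<tau>) y = ell2_inner x (y \<circ> \<tau>)"
  using infsum_reindex_bij_betw[OF involution_bij[of \<tau>, OF \<tau>], of "\<lambda>n. x (\<tau> n) * cnj (y n)"]
  by (simp add: ell2_inner_def \<tau>)

lemma inner_product_space_ell2_space:
  assumes \<tau>: "\<And>n. \<tau> (\<tau> n) = n"
  shows "inner_product_space (ell2_space \<tau>)"
proof -
  have bij: "bij \<tau>" using \<tau> by (rule involution_bij)
  have vs: "vector_space (\<lambda>a (x :: nat \<Rightarrow> complex) n. a * x n)"
    by unfold_locales (auto simp: fun_eq_iff algebra_simps)
  have "0 \<in> ell2" by (rule ell2I[of _ 0]) simp
  then have subspace: "module.subspace (\<lambda>a x n. a * x n) ell2"
    using vs by (intro module.subspaceI)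
      (auto simp: module_iff_vector_space ell2_add ell2_scale)
  have add: "(x + y) \<circ> \<tau> = (x \<circ> \<tau>) + (y \<circ> \<tau>)" for x y :: "nat \<Rightarrow> complex"
    by (simp add: fun_eq_iff)
  have scale: "(\<lambda>n. a * x n) \<circ> \<tau> = (\<lambda>n. a * (x \<circ> \<tau>) n)" for a and x :: "nat \<Rightarrow> complex"
    by (simp add: fun_eq_iff)
  have "ell2_inner (y \<circ> \<tau>) x = cnj (ell2_inner (x \<circ> \<tau>) y)" for x y
    unfolding ell2_inner_permute[of \<tau> y x, OF \<tau>] by (rule ell2_inner_commute)
  then show ?thesis
    unfolding inner_product_space_def ell2_space_simps add scale
    using vs subspace bij by (intro conjI ballI allI)
      (assumption | blast | intro ell2_inner_add ell2_inner_scale ell2_permute)+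
qed

section \<open>Norm and completeness of \<open>ell2\<close>\<close>

lemma form_norm_ell2:
  "x \<in> ell2 \<Longrightarrow> form_norm (ell2_space id) x = sqrt (\<Sum>\<^sub>\<infinity>n. (cmod (x n))\<^sup>2)"
  by (simp add: form_norm_def ell2_inner_self)

lemma sum_le_form_norm_ell2:
  assumes "x \<in> ell2" "finite F"
  shows "(\<Sum>n\<in>F. (cmod (x n))\<^sup>2) \<le> (form_norm (ell2_space id) x)\<^sup>2"
  using assms finite_sum_le_infsum[of "\<lambda>n. (cmod (x n))\<^sup>2" UNIV F]
  by (simp add: form_norm_ell2 infsum_nonneg) (simp add: ell2_def)

lemma norm_le_form_norm_ell2:
  assumes "x \<in> ell2"
  shows "cmod (x n) \<le> form_norm (ell2_space id) x"
  using sum_le_form_norm_ell2[OF assms, of "{n}"] assms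
  by (simp add: form_norm_ell2 infsum_nonneg real_le_rsqrt)

lemma form_norm_ell2_le:
  assumes "0 \<le> b" "\<And>F. finite F \<Longrightarrow> (\<Sum>n\<in>F. (cmod (x n))\<^sup>2) \<le> b\<^sup>2"
  shows "form_norm (ell2_space id) x \<le> b"
proof -
  have "x \<in> ell2" using assms(2) by (rule ell2I)
  moreover have "(\<Sum>\<^sub>\<infinity>n. (cmod (x n))\<^sup>2) \<le> b\<^sup>2"
    using \<open>x \<in> ell2\<close> assms by (intro infsum_le_finite_sums) (auto simp: ell2_def)
  ultimately show ?thesis
    using assms(1) by (simp add: form_norm_ell2 real_le_lsqrt)
qed

lemma pre_hilbert_ell2: "pre_hilbert (ell2_space id)"
proof
  show "inner_product_space (ell2_space id)"
    by (rule inner_product_space_ell2_space) simp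
  fix x assume x: "x \<in> carrier (ell2_space id)" "x \<noteq> 0"
  then obtain n where "x n \<noteq> 0" by (auto simp: fun_eq_iff)
  then have "0 < form_norm (ell2_space id) x"
    using norm_le_form_norm_ell2[of x n] x
    by (metis ell2_space_simps(1) less_le_trans zero_less_norm_iff)
  then show "0 < Re (form (ell2_space id) x x)"
    by (simp only: form_norm_def real_sqrt_gt_0_iff)
qed

text \<open>A Cauchy sequence converges in each coordinate. Its Cauchy estimate, restricted to
  finitely many coordinates, survives the limit in one index, and the resulting bound is uniform in
  the finite set.\<close>

lemma hilbert_space_ell2: "hilbert_space (ell2_space id)"
proof -
  interpret pre_hilbert "ell2_space id" rewrites "carrier (ell2_space id) = ell2"
    by (simp_all add: pre_hilbert_ell2)
  let ?N = "form_norm (ell2_space id)"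
  have "\<exists>x. limitin mtopology s x sequentially" if "MCauchy s" for s
  proof -
    from that have s: "s n \<in> ell2" for n by (auto simp: MCauchy_def)
    then have diff: "s m - s n \<in> ell2" for m n using carrier_diff[of "s m" "s n"] by simp
    have cauchy: "\<exists>N. \<forall>m\<ge>N. \<forall>n\<ge>N. ?N (s m - s n) < e" if "e > 0" for e
      using \<open>MCauchy s\<close> that s by (fastforce simp: MCauchy_def form_dist_def)
    have "\<exists>l. (\<lambda>n. s n i) \<longlonglongrightarrow> l" for i
    proof -
      have "Cauchy (\<lambda>n. s n i)"
      proof (rule metric_CauchyI)
        fix e :: real assume "e > 0"
        then obtain N where N: "\<forall>m\<ge>N. \<forall>n\<ge>N. ?N (s m - s n) < e"
          using cauchy by blast
        have "dist (s m i) (s n i) < e" if "m \<ge> N" "n \<ge> N" for m n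
          using norm_le_form_norm_ell2[OF diff, of m n i] N that
          by (force simp: dist_norm)
        then show "\<exists>M. \<forall>m\<ge>M. \<forall>n\<ge>M. dist (s m i) (s n i) < e" by blast
      qed
      then show ?thesis by (simp add: Cauchy_convergent convergentD)
    qed
    then obtain x where x: "\<And>i. (\<lambda>n. s n i) \<longlonglongrightarrow> x i" by metis
    have lim: "\<exists>N. \<forall>n\<ge>N. s n - x \<in> ell2 \<and> ?N (s n - x) \<le> e" if e: "e > 0" for e
    proof -
      from cauchy[OF e] obtain N where N: "\<And>m n. m \<ge> N \<Longrightarrow> n \<ge> N \<Longrightarrow> ?N (s n - s m) < e"
        by blast
      \<comment> \<open>With \<open>n\<close> and \<open>F\<close> fixed, let \<open>m\<close> tend
        to infinity in the estimate for \<open>s n - s m\<close>; the strict inequality weakens to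
        \<open>\<le>\<close>.\<close>
      have "(\<Sum>i\<in>F. (cmod ((s n - x) i))\<^sup>2) \<le> e\<^sup>2" if n: "n \<ge> N" and F: "finite F" for n F
      proof (rule tendsto_upperbound)
        show "(\<lambda>m. \<Sum>i\<in>F. (cmod (s n i - s m i))\<^sup>2) \<longlonglongrightarrow> (\<Sum>i\<in>F. (cmod ((s n - x) i))\<^sup>2)"
          using x by (auto intro!: tendsto_intros)
        have "(\<Sum>i\<in>F. (cmod (s n i - s m i))\<^sup>2) \<le> e\<^sup>2" if "m \<ge> N" for m
        proof -
          have "(\<Sum>i\<in>F. (cmod (s n i - s m i))\<^sup>2) \<le> (?N (s n - s m))\<^sup>2"
            using sum_le_form_norm_ell2[OF diff F, of n m] by simp
          also have "\<dots> \<le> e\<^sup>2"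
            using N[OF that n] diff[of n m] form_norm_nonneg[of "s n - s m"]
            by (intro power_mono) auto
          finally show ?thesis .
        qed
        then show "\<forall>\<^sub>F m in sequentially. (\<Sum>i\<in>F. (cmod (s n i - s m i))\<^sup>2) \<le> e\<^sup>2"
          by (auto simp: eventually_sequentially)
      qed simp
      then have "s n - x \<in> ell2 \<and> ?N (s n - x) \<le> e" if "n \<ge> N" for n
        using that e by (intro conjI ell2I[of _ "e\<^sup>2"] form_norm_ell2_le) auto
      then show ?thesis by blast
    qed
    \<comment> \<open>One such \<open>n\<close> suffices, since \<open>x\<close> is
      \<open>s n\<close> minus this difference.\<close>
    obtain n where "s n - x \<in> ell2" using lim[of 1] by auto
    then have x_in: "x \<in> ell2"
      using s[of n] carrier_diff[of "s n" "s n - x"] by simp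
    have "limitin mtopology s x sequentially"
      unfolding limit_metric_sequentially
    proof (intro conjI allI impI)
      fix e :: real assume "e > 0"
      \<comment> \<open>Halving \<open>e\<close> recovers the strict inequality.\<close>
      then obtain N where "\<forall>n\<ge>N. ?N (s n - x) \<le> e / 2"
        using lim[of "e / 2"] by auto
      then show "\<exists>N. \<forall>n\<ge>N. s n \<in> ell2 \<and> form_dist (ell2_space id) (s n) x < e"
        using s x_in \<open>e > 0\<close> by (force simp: form_dist_def)
    qed (use x_in in simp)
    then show ?thesis by blast
  qed
  then have mcomplete by (simp add: mcomplete_def)
  then show ?thesis
    using inner_product_space pos by (simp add: hilbert_space_def)
qed

section \<open>Krein spaces on \<open>ell2\<close>\<close>

lemma fundamental_symmetry_ell2:
  assumes \<tau>: "\<And>n. \<tau> (\<tau> n) = n"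
  shows "fundamental_symmetry (ell2_space \<tau>) ell2_inner (\<lambda>x. x \<circ> \<tau>)"
proof -
  have "bij \<tau>" using \<tau> by (rule involution_bij)
  moreover have "x \<circ> \<tau> \<circ> \<tau> = x" for x :: "nat \<Rightarrow> complex"
    by (simp add: fun_eq_iff \<tau>)
  ultimately show ?thesis
    using hilbert_space_ell2 ell2_inner_permute[of \<tau>, OF \<tau>]
    by (auto simp: fundamental_symmetry_def linear_between_def ell2_permute fun_eq_iff)
qed

lemma krein_space_ell2: "(\<And>n. \<tau> (\<tau> n) = n) \<Longrightarrow> krein_space (ell2_space \<tau>)"
  unfolding krein_space_def
  using inner_product_space_ell2_space fundamental_symmetry_ell2 by blast

section \<open>Weighted permutations\<close>

text \<open>The common shape of all four operators of the counterexample, so that boundedness is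
  proved only once. The restriction to \<open>ell2\<close> makes the operator extensional, as
  \<open>bounded_ops\<close> demands.\<close>

definition weighted_perm ::
  "(nat \<Rightarrow> complex) \<Rightarrow> (nat \<Rightarrow> nat) \<Rightarrow> (nat \<Rightarrow> complex) \<Rightarrow> (nat \<Rightarrow> complex)" where
  "weighted_perm u \<rho> = (\<lambda>x\<in>ell2. \<lambda>n. u n * x (\<rho> n))"

text \<open>The permutation preserves the norm, and weights of modulus at most 1 do not increase
  it.\<close>

lemma weighted_perm_ell2:
  assumes \<rho>: "\<And>n. \<rho> (\<rho> n) = n" and u: "\<And>n. cmod (u n) \<le> 1" and x: "x \<in> ell2"
  shows "weighted_perm u \<rho> x \<in> ell2"
    and "form_norm (ell2_space id) (weighted_perm u \<rho> x) \<le> form_norm (ell2_space id) x"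
proof -
  have bij: "bij \<rho>" using \<rho> by (rule involution_bij)
  have le: "(cmod (weighted_perm u \<rho> x n))\<^sup>2 \<le> (cmod (x (\<rho> n)))\<^sup>2" for n
    using mult_right_mono[OF u[of n], of "cmod (x (\<rho> n))"] x
    by (simp add: weighted_perm_def norm_mult power_mono)
  have "x \<circ> \<rho> \<in> ell2" using x bij by (rule ell2_permute)
  then have summable: "(\<lambda>n. (cmod (x (\<rho> n)))\<^sup>2) summable_on UNIV"
    by (simp add: ell2_def)
  then show 1: "weighted_perm u \<rho> x \<in> ell2"
    unfolding ell2_def mem_Collect_eq by (rule summable_on_comparison_test) (use le in auto)
  then have "(\<Sum>\<^sub>\<infinity>n. (cmod (weighted_perm u \<rho> x n))\<^sup>2) \<le> (\<Sum>\<^sub>\<infinity>n. (cmod (x (\<rho> n)))\<^sup>2)"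
    using summable le by (intro infsum_mono) (auto simp: ell2_def)
  also have "\<dots> = (\<Sum>\<^sub>\<infinity>n. (cmod (x n))\<^sup>2)"
    using bij by (rule infsum_reindex_bij_betw)
  finally show "form_norm (ell2_space id) (weighted_perm u \<rho> x) \<le> form_norm (ell2_space id) x"
    using 1 x by (simp add: form_norm_ell2)
qed

lemma strong_norm_ell2_equivalent:
  assumes "\<And>n. \<tau> (\<tau> n) = n"
  obtains C D where "C > 0" "D > 0"
    "\<And>x. x \<in> ell2 \<Longrightarrow> strong_norm (ell2_space \<tau>) x \<le> C * form_norm (ell2_space id) x"
    "\<And>x. x \<in> ell2 \<Longrightarrow> form_norm (ell2_space id) x \<le> D * strong_norm (ell2_space \<tau>) x"
  using strong_norm_equivalent[OF fundamental_symmetry_ell2[of \<tau>, OF assms]]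
  unfolding ell2_space_simps by metis

text \<open>A contraction for the \<open>ell2\<close> norm is bounded for the strong norms of source
  and target, with the product of two equivalence constants as bound.\<close>

lemma weighted_perm_bounded:
  assumes \<rho>: "\<And>n. \<rho> (\<rho> n) = n" and u: "\<And>n. cmod (u n) \<le> 1"
    and \<tau>: "\<And>n. \<tau> (\<tau> n) = n" and \<upsilon>: "\<And>n. \<upsilon> (\<upsilon> n) = n"
  shows "weighted_perm u \<rho> \<in> bounded_ops (ell2_space \<tau>) (ell2_space \<upsilon>)"
proof -
  let ?W = "weighted_perm u \<rho>" and ?N = "form_norm (ell2_space id)"
  obtain C C' where C: "C > 0" "C' > 0"
      "\<And>x. x \<in> ell2 \<Longrightarrow> strong_norm (ell2_space \<upsilon>) x \<le> C * ?N x"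
      "\<And>x. x \<in> ell2 \<Longrightarrow> ?N x \<le> C' * strong_norm (ell2_space \<upsilon>) x"
    by (rule strong_norm_ell2_equivalent[of \<upsilon>, OF \<upsilon>]) (rule that; blast)
  obtain D D' where D: "D' > 0" "D > 0"
      "\<And>x. x \<in> ell2 \<Longrightarrow> strong_norm (ell2_space \<tau>) x \<le> D' * ?N x"
      "\<And>x. x \<in> ell2 \<Longrightarrow> ?N x \<le> D * strong_norm (ell2_space \<tau>) x"
    by (rule strong_norm_ell2_equivalent[of \<tau>, OF \<tau>]) (rule that; blast)
  note W = weighted_perm_ell2[of \<rho> u, OF \<rho> u]
  have "strong_norm (ell2_space \<upsilon>) (?W x) \<le> (C * D) * strong_norm (ell2_space \<tau>) x"
    if x: "x \<in> ell2" for x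
  proof -
    have "strong_norm (ell2_space \<upsilon>) (?W x) \<le> C * ?N (?W x)"
      using C(3) W(1)[OF x] by blast
    also have "\<dots> \<le> C * (D * strong_norm (ell2_space \<tau>) x)"
      using W(2)[OF x] D(4)[OF x] C(1) by (intro mult_left_mono) auto
    finally show ?thesis by simp
  qed
  then have "\<exists>c. \<forall>x\<in>ell2. strong_norm (ell2_space \<upsilon>) (?W x) \<le> c * strong_norm (ell2_space \<tau>) x"
    by blast
  moreover have "?W \<in> ell2 \<rightarrow>\<^sub>E ell2"
    using W(1) by (auto simp: weighted_perm_def)
  moreover have "linear_between (ell2_space \<tau>) (ell2_space \<upsilon>) ?W"
    using W(1) ell2_add ell2_scale
    by (auto simp: linear_between_def weighted_perm_def fun_eq_iff algebra_simps)
  ultimately show ?thesis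
    by (simp add: bounded_ops_def)
qed

text \<open>As \<open>form_adjoint\<close> is a definite description, uniqueness of the adjoint has
  to be shown as well; positive definiteness provides it on \<open>ell2\<close> and extensionality
  outside.\<close>

lemma selfadjoint_op_ell2:
  assumes A: "A \<in> bounded_ops (ell2_space id) (ell2_space id)"
    and sym: "\<And>x y. x \<in> ell2 \<Longrightarrow> y \<in> ell2 \<Longrightarrow> ell2_inner (A x) y = ell2_inner x (A y)"
  shows "selfadjoint_op (ell2_space id) A"
proof -
  interpret pre_hilbert "ell2_space id" rewrites "carrier (ell2_space id) = ell2"
    by (simp_all add: pre_hilbert_ell2)
  have "S = A" if S: "S \<in> bounded_ops (ell2_space id) (ell2_space id)"
    and adj: "\<And>x y. x \<in> ell2 \<Longrightarrow> y \<in> ell2 \<Longrightarrow> ell2_inner (A x) y = ell2_inner x (S y)" for S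
  proof (rule extensionalityI)
    show "S \<in> extensional ell2" "A \<in> extensional ell2"
      using S A by (auto simp: bounded_ops_def PiE_def)
    fix y assume y: "y \<in> ell2"
    then have in2: "S y \<in> ell2" "A y \<in> ell2"
      using S A by (auto simp: bounded_ops_def)
    then have d: "S y - A y \<in> ell2" using carrier_diff[of "S y" "A y"] by simp
    \<comment> \<open>Both adjoint relations are tested on the vector \<open>S y - A y\<close>
      itself.\<close>
    then have "ell2_inner (S y - A y) (S y - A y) = 0"
      using form_diff_right[of "S y" "A y" "S y - A y"] in2 adj[OF d y] sym[OF d y] by simp
    then show "S y = A y" using pos[of "S y - A y"] d by auto
  qed
  then show ?thesis
    unfolding selfadjoint_op_def form_adjoint_def
    using A sym by (auto intro!: the_equality)
qed

section \<open>The counterexample\<close>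

text \<open>Coordinates \<open>2 * k\<close> and \<open>2 * k + 1\<close> together form one
  hyperbolic plane. The subtraction never truncates, because an odd \<open>n\<close> is at least
  1.\<close>

definition swap :: "nat \<Rightarrow> nat" where
  "swap n = (if even n then n + 1 else n - 1)"

lemma swap_swap [simp]: "swap (swap n) = n"
  by (auto simp: swap_def)

lemma even_swap [simp]: "even (swap n) \<longleftrightarrow> odd n"
  by (auto simp: swap_def)

text \<open>The diagonal of \<Pi>: 1 on the even coordinates, the entries
  \<open>1 / (2 * k + 2)\<close> of \<open>D\<close> on the odd ones. No entry vanishes, which gives
  dense range; those of \<open>D\<close> tend to 0, which makes its inverse unbounded.\<close>

definition weight :: "nat \<Rightarrow> complex" where
  "weight n = (if even n then 1 else 1 / (of_nat n + 1))"

lemma norm_weight_le: "cmod (weight n) \<le> 1"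
proof -
  have "1 \<le> cmod (of_nat n + 1)"
    using norm_of_nat[of "Suc n", where 'a = complex] by (simp add: add.commute)
  then show ?thesis by (simp add: weight_def norm_divide divide_le_eq_1)
qed

lemma cnj_weight [simp]: "cnj (weight n) = weight n"
  by (simp add: weight_def)

lemma weight_nonzero: "weight n \<noteq> 0"
  using of_nat_neq_0[of n, where 'a = complex] by (simp add: weight_def add.commute)

text \<open>Finite truncations of \<open>z\<close> approximate it, and they lie in the range because
  every weight can be divided out.\<close>

lemma weight_dense:
  assumes z: "z \<in> ell2" and e: "e > 0"
  shows "\<exists>x\<in>weighted_perm weight id ` ell2. form_norm (ell2_space id) (z - x) < e"
proof -
  define f where "f n = (cmod (z n))\<^sup>2" for n
  have f: "f summable_on UNIV" using z by (simp add: ell2_def f_def[abs_def])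
  \<comment> \<open>The half leaves room for the strict inequality at the end.\<close>
  obtain F where F: "finite F" "dist (sum f F) (infsum f UNIV) \<le> e\<^sup>2 / 2"
    using infsum_finite_approximation[OF f, of "e\<^sup>2 / 2"] e by auto
  define y where "y n = (if n \<in> F then z n / weight n else 0)" for n
  have y: "y \<in> ell2"
  proof (rule ell2I)
    fix G :: "nat set" assume "finite G"
    then have "(\<Sum>n\<in>G. (cmod (y n))\<^sup>2) = (\<Sum>n\<in>G \<inter> F. (cmod (y n))\<^sup>2)"
      by (intro sum.mono_neutral_right) (auto simp: y_def)
    also have "\<dots> \<le> (\<Sum>n\<in>F. (cmod (y n))\<^sup>2)"
      using F(1) by (intro sum_mono2) auto
    finally show "(\<Sum>n\<in>G. (cmod (y n))\<^sup>2) \<le> (\<Sum>n\<in>F. (cmod (y n))\<^sup>2)" .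
  qed
  have z_y: "(z - weighted_perm weight id y) n = (if n \<in> F then 0 else z n)" for n
    using y weight_nonzero[of n] by (simp add: weighted_perm_def y_def)
  have "form_norm (ell2_space id) (z - weighted_perm weight id y) \<le> sqrt (e\<^sup>2 / 2)"
  proof (rule form_norm_ell2_le)
    fix G :: "nat set" assume G: "finite G"
    \<comment> \<open>The error is the part of \<open>z\<close> outside \<open>F\<close>, so its
      partial sums are bounded by the tail of \<open>f\<close>.\<close>
    have "(\<Sum>n\<in>G. (cmod ((z - weighted_perm weight id y) n))\<^sup>2) = sum f (G - F)"
      unfolding z_y using G by (intro sum.mono_neutral_cong_right) (auto simp: f_def)
    also have "\<dots> = sum f (G \<union> F) - sum f F"
      using G F(1) sum.subset_diff[of F "G \<union> F" f] by (simp add: Un_Diff)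
    also have "\<dots> \<le> infsum f UNIV - sum f F"
      using finite_sum_le_infsum[OF f, of "G \<union> F"] G F(1) by (simp add: f_def)
    also have "\<dots> \<le> e\<^sup>2 / 2"
      using F(2) unfolding dist_real_def by linarith
    finally show "(\<Sum>n\<in>G. (cmod ((z - weighted_perm weight id y) n))\<^sup>2) \<le> (sqrt (e\<^sup>2 / 2))\<^sup>2"
      by simp
  qed simp
  also have "sqrt (e\<^sup>2 / 2) < e"
    using e by (intro real_less_lsqrt) auto
  finally show ?thesis using y by blast
qed

section \<open>Unit vectors, the test vectors for unboundedness\<close>

definition unit_vec :: "nat \<Rightarrow> nat \<Rightarrow> complex" where
  "unit_vec m n = (if n = m then 1 else 0)"

lemma sum_unit_vec_le:
  assumes "finite F"
  shows "(\<Sum>n\<in>F. (cmod (unit_vec m n))\<^sup>2) \<le> 1"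
proof -
  have "(cmod (unit_vec m n))\<^sup>2 = (if n = m then 1 else 0)" for n
    by (simp add: unit_vec_def)
  then show ?thesis using assms by simp
qed

lemma unit_vec_ell2 [simp]: "unit_vec m \<in> ell2"
  using sum_unit_vec_le by (rule ell2I)

lemma form_norm_unit_vec_le: "form_norm (ell2_space id) (unit_vec m) \<le> 1"
  by (rule form_norm_ell2_le) (simp_all add: sum_unit_vec_le)

theorem theorem2p3:
  shows "\<exists>(H :: (nat \<Rightarrow> complex) form_space) A (K :: (nat \<Rightarrow> complex) form_space) P.
           krein_space H \<and> selfadjoint_op H A \<and> induced_krein_space H A K P \<and>
           \<not> lifting_property H A K P"
proof (intro exI conjI)
  let ?H = "ell2_space id" and ?K = "ell2_space swap"
  let ?N = "form_norm (ell2_space id)"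
  \<comment> \<open>One of the two weights is always 1, so both coordinates of a plane get the same
    entry of \<open>D\<close>.\<close>
  define A where "A = weighted_perm (\<lambda>n. weight n * weight (swap n)) swap"
  define P where "P = weighted_perm weight id"
  define T where "T = weighted_perm (\<lambda>n. if even n then 1 else 0) swap"
  define S where "S = weighted_perm (\<lambda>n. if odd n then 1 else 0) swap"
  have A: "A \<in> bounded_ops ?H ?H"
    unfolding A_def using norm_weight_le
    by (intro weighted_perm_bounded) (auto simp: norm_mult mult_le_one)
  have T: "T \<in> bounded_ops ?H ?H" and S: "S \<in> bounded_ops ?H ?H"
    unfolding T_def S_def by (intro weighted_perm_bounded; simp)+
  have P: "P \<in> bounded_ops ?H ?K"
    unfolding P_def using norm_weight_le by (intro weighted_perm_bounded) auto
  have in2: "A x \<in> ell2" "P x \<in> ell2" "T x \<in> ell2" "S x \<in> ell2" if "x \<in> ell2" for x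
    using A P T S that by (auto simp: bounded_ops_def)
  \<comment> \<open>The sums agree term by term: the weight in the second argument is real and joins
    the one in the first.\<close>
  have A_form: "ell2_inner (P x \<circ> swap) (P y) = ell2_inner (A x) y"
    if "x \<in> ell2" "y \<in> ell2" for x y
    using that by (simp add: ell2_inner_def A_def P_def weighted_perm_def mult_ac)
  show "krein_space ?H" by (rule krein_space_ell2) simp
  show "selfadjoint_op ?H A"
  proof (rule selfadjoint_op_ell2[OF A])
    \<comment> \<open>Symmetry of \<open>A\<close> is inherited from the Hermitian form
      \<open>[P x, P y]\<close> through \<open>A_form\<close>.\<close>
    show "ell2_inner (A x) y = ell2_inner x (A y)" if "x \<in> ell2" "y \<in> ell2" for x y
      using that A_form[of x y] A_form[of y x] ell2_inner_permute[of swap "P x" "P y"]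
        ell2_inner_commute[of "P x \<circ> swap" "P y"]
        ell2_inner_commute[of x "A y"] ell2_inner_commute[of "P x" "P y \<circ> swap"]
      by simp
  qed
  show "induced_krein_space ?H A ?K P"
    unfolding induced_krein_space_def
  proof (intro conjI)
    show "krein_space ?K" by (rule krein_space_ell2) simp
    show "strong_topology ?K closure_of (P ` carrier ?H) = carrier ?K"
      by (rule strong_closure_of[OF fundamental_symmetry_ell2])
        (use in2 weight_dense in \<open>auto simp: P_def\<close>)
  qed (use P A_form in simp_all)
  show "\<not> lifting_property ?H A ?K P"
  proof
    \<comment> \<open>Both products send \<open>(x, y)\<close> to \<open>(0, D y)\<close>.\<close>
    have "compose (carrier ?H) A T = compose (carrier ?H) S A"
      using in2 by (auto simp: compose_def fun_eq_iff restrict_def)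
        (auto simp: A_def S_def T_def weighted_perm_def mult_ac)
    moreover assume "lifting_property ?H A ?K P"
    ultimately obtain L where L: "L \<in> bounded_ops ?K ?K"
      and "compose (carrier ?H) L P = compose (carrier ?H) P T"
      using T S unfolding lifting_property_def by blast
    then have LP: "L (P x) = P (T x)" if "x \<in> ell2" for x
      using that by (metis compose_eq ell2_space_simps(1))
    obtain c where c: "\<And>x. x \<in> ell2 \<Longrightarrow> strong_norm ?K (L x) \<le> c * strong_norm ?K x"
      using L by (auto simp: bounded_ops_def)
    obtain C D where C: "C > 0" and D: "D > 0"
      and CN: "\<And>x. x \<in> ell2 \<Longrightarrow> strong_norm ?K x \<le> C * ?N x"
      and DN: "\<And>x. x \<in> ell2 \<Longrightarrow> ?N x \<le> D * strong_norm ?K x"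
      by (rule strong_norm_ell2_equivalent[of swap, OF swap_swap]) (rule that; blast)
    interpret pre_hilbert ?H rewrites "carrier ?H = ell2"
      by (simp_all add: pre_hilbert_ell2)
    have bound: "of_nat (2 * k + 2) \<le> D * (\<bar>c\<bar> * C)" for k
    proof -
      \<comment> \<open>\<open>P\<close> shrinks this vector by the factor
        \<open>1 / (2 * k + 2)\<close>, whereas \<open>T\<close> moves it to the even index
        \<open>2 * k\<close>, where \<open>P\<close> has weight 1. So \<open>L\<close> would have to
        stretch \<open>P ?x\<close> by \<open>2 * k + 2\<close>.\<close>
      let ?x = "unit_vec (2 * k + 1)"
      have "1 = cmod (P (T ?x) (2 * k))"
        using in2(3)[of ?x]
        by (simp add: P_def) (simp add: T_def weighted_perm_def weight_def unit_vec_def swap_def)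
      also have "\<dots> \<le> ?N (P (T ?x))"
        using in2 by (intro norm_le_form_norm_ell2) auto
      also have "\<dots> \<le> D * strong_norm ?K (L (P ?x))"
        using DN in2 LP by simp
      also have "strong_norm ?K (L (P ?x)) \<le> c * strong_norm ?K (P ?x)"
        using c in2 by simp
      \<comment> \<open>The sign of \<open>c\<close> is unknown, hence the absolute value.\<close>
      also have "c * strong_norm ?K (P ?x) \<le> \<bar>c\<bar> * (C * ?N (P ?x))"
      proof (rule mult_mono)
        \<comment> \<open>The strong norm is nonnegative here because \<open>D\<close> times it
          dominates the \<open>ell2\<close> norm.\<close>
        have "0 \<le> D * strong_norm ?K (P ?x)"
          using DN in2 form_norm_nonneg by (meson order_trans unit_vec_ell2)
        then show "0 \<le> strong_norm ?K (P ?x)" using D by (simp add: zero_le_mult_iff)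
      qed (use C CN in2 in auto)
      also have "P ?x = (\<lambda>n. weight (2 * k + 1) * ?x n)"
        by (auto simp: P_def weighted_perm_def unit_vec_def fun_eq_iff)
      also have "?N \<dots> = cmod (weight (2 * k + 1)) * ?N ?x"
        using form_norm_scale[of ?x "weight (2 * k + 1)"] by simp
      also have "\<dots> \<le> cmod (weight (2 * k + 1))"
        using form_norm_unit_vec_le by (simp add: mult_left_le)
      also have "\<dots> = 1 / of_nat (2 * k + 2)"
        using norm_of_nat[of "2 * k + 2", where 'a = complex]
        by (simp add: weight_def norm_divide add_ac)
      finally have "1 \<le> D * (\<bar>c\<bar> * (C * (1 / of_nat (2 * k + 2))))"
        using C D by (simp add: mult_left_mono)
      then show ?thesis by (simp add: field_simps)
    qed
    \<comment> \<open>The bound does not depend on \<open>k\<close>, while its left side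
      \<open>2 * k + 2\<close> exceeds \<open>k\<close>.\<close>
    obtain k :: nat where "D * (\<bar>c\<bar> * C) < of_nat k" using reals_Archimedean2 by blast
    with bound[of k] show False by simp
  qed
qed

end
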